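(* Let $T_0,\boldsymbol{\nu}_0,\boldsymbol{t}_0=-T_0\boldsymbol{1}$ be the parameters of a phase-type distribution on $n$ phases, let $\theta>0$, $G_0(\theta)=\boldsymbol{\nu}_0(\theta\mathbb{I}-T_0)^{-1}\boldsymbol{t}_0$ and $d=-\log G_0(\theta)>0$. Let $\Delta$ be the diagonal matrix with the vector $(\theta\mathbb{I}-T_0)^{-1}\boldsymbol{t}_0$ on the diagonal, and let $$T_1=\Delta^{-1}T_0\Delta-\theta\mathbb{I},\qquad \boldsymbol{\nu}_1=\boldsymbol{\nu}_0\Delta/G_0(\theta),\qquad \boldsymbol{t}_1=\Delta^{-1}\boldsymbol{t}_0 .$$ For $i\in\{0,1\}$ let $F_i(s)=T_i+\theta s\mathbb{I}+\boldsymbol{t}_i\boldsymbol{\nu}_i e^{-ds}$ and let $W_i(x)$, $x\ge 0$, be the continuous matrix-valued function (scale function) with $\int_0^\infty e^{-sx}W_i(x)\,dx=F_i(s)^{-1}$ for all sufficiently large $s$. Then $$W_1(x)=e^{x}\Delta^{-1}W_0(x)\Delta\qquad\text{for all }x\geq 0.$$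
   Context: Phase-type (PH) distributions: a PH distribution is the law of the life time (time to absorption) of a transient continuous-time Markov chain on finitely many states $1,\ldots,n$. It is parametrized by the $n\times n$ transition rate matrix $T$ of the chain restricted to the transient states (off-diagonal entries nonnegative, row sums nonpositive, all states transient), the row vector $\boldsymbol{\nu}$ giving the initial distribution on $\{1,\ldots,n\}$ (a probability vector), and the column vector of absorption rates $\boldsymbol{t}=-T\boldsymbol{1}$. Its density is $f(x)=\boldsymbol{\nu}e^{Tx}\boldsymbol{t}$. Here $\boldsymbol{1}$ is the column vector of ones and $\mathbb{I}$ is the $n\times n$ identity matrix. $G_0(\theta)$ is the Laplace transform at $\theta$ of the density $f_0(x)=\boldsymbol{\nu}_0e^{T_0x}\boldsymbol{t}_0$. The parameters $T_1,\boldsymbol{\nu}_1,\boldsymbol{t}_1$ are known to be PH parameters of the exponentially tilted density $f_1(x)=\frac{1}{G_0(\theta)}e^{-\theta x}f_0(x)$. The diagonal entries of $\Delta$ lie in $(0,1)$, so $\Delta$ is invertible. $F_i$ characterizes the Markov additive process $(X_t,J_t)$ in which $X_t=\theta t-dN_t$, $N_t$ is a renewal process with PH$(T_i,\boldsymbol{\nu}_i)$ inter-arrival times, and $J_t$ is the phase of the current inter-arrival time. It is known from the general theory that the continuous functions $W_i$ with the given transforms exist and are unique. *)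

theory Defs
  imports "HOL-Analysis.Analysis"
begin

primrec mat_power :: "real^'n^'n \<Rightarrow> nat \<Rightarrow> real^'n^'n" where
  "mat_power A 0 = mat 1"
| "mat_power A (Suc k) = A ** mat_power A k"

(* The class-based exp is not available here: real^'n^'n is not an instance of
   real_normed_algebra_1, and its multiplication is componentwise. *)
definition mat_exp :: "real^'n^'n \<Rightarrow> real^'n^'n" where
  "mat_exp A = (\<Sum>k. (1 / fact k) *\<^sub>R mat_power A k)"

definition diag_mat :: "real^'n \<Rightarrow> real^'n^'n" where
  "diag_mat v = (\<chi> i j. if i = j then v $ i else 0)"

(* Possibly defective rate matrix: the missing mass of row i is the absorption rate from i. *)
definition subintensity :: "real^'n^'n \<Rightarrow> bool" where
  "subintensity T \<longleftrightarrow>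
     (\<forall>i j. i \<noteq> j \<longrightarrow> 0 \<le> T $ i $ j) \<and> (\<forall>i. (\<Sum>j\<in>UNIV. T $ i $ j) \<le> 0)"

(* mat_exp (x T) (i, i) is the probability of being in i at time x when started from i, so
   its integral is the expected total time spent in i. For the nonnegative integrand,
   integrable_on means that this expectation is finite. *)
definition transient_state :: "real^'n^'n \<Rightarrow> 'n \<Rightarrow> bool" where
  "transient_state T i \<longleftrightarrow> (\<lambda>x. mat_exp (x *\<^sub>R T) $ i $ i) integrable_on {0..}"

definition probability_vector :: "real^'n \<Rightarrow> bool" where
  "probability_vector v \<longleftrightarrow> (\<forall>i. 0 \<le> v $ i) \<and> (\<Sum>i\<in>UNIV. v $ i) = 1"

(* The vector 1 has all entries equal to 1. *)
definition exit_rates :: "real^'n^'n \<Rightarrow> real^'n" where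
  "exit_rates T = - (T *v 1)"

definition phase_type :: "real^'n^'n \<Rightarrow> real^'n \<Rightarrow> real^'n \<Rightarrow> bool" where
  "phase_type T \<nu> t \<longleftrightarrow>
     subintensity T \<and> (\<forall>i. transient_state T i) \<and> probability_vector \<nu> \<and> t = exit_rates T"

(* Matrix exponent of the additive process with drift \<theta>, jumps -d at the renewals and
   PH(T, \<nu>) inter-arrival times; the last summand is the rank-one matrix t \<nu> exp(-d s). *)
definition map_exponent ::
    "real^'n^'n \<Rightarrow> real^'n \<Rightarrow> real^'n \<Rightarrow> real \<Rightarrow> real \<Rightarrow> real \<Rightarrow> real^'n^'n" where
  "map_exponent T \<nu> t \<theta> d s =
     T + (\<theta> * s) *\<^sub>R mat 1
       + exp (- d * s) *\<^sub>R ((columnvector t :: real^1^'n) ** (rowvector \<nu> :: real^'n^1))"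

(* W is only constrained on {0..}. Invertibility is stated because matrix_inv is
   unspecified on singular matrices. *)
definition is_scale_function :: "(real \<Rightarrow> real^'n^'n) \<Rightarrow> (real \<Rightarrow> real^'n^'n) \<Rightarrow> bool" where
  "is_scale_function F W \<longleftrightarrow>
     continuous_on {0..} W \<and>
     (\<forall>\<^sub>F s in at_top. invertible (F s) \<and>
        ((\<lambda>x. exp (- s * x) *\<^sub>R W x) has_integral matrix_inv (F s)) {0..})"

end

theory Submission
  imports Defs
begin

text \<open>
  Conjugation by \<open>\<Delta>\<close> and a unit shift of the argument turn one exponent into the other: since
  \<open>e\<^sup>d = 1 / G\<^sub>0\<close>, the factor \<open>1 / G\<^sub>0\<close> carried by \<open>\<nu>\<^sub>1\<close> is absorbed into the jump term and
  \<open>F\<^sub>1(s) = \<Delta>\<^sup>-\<^sup>1 F\<^sub>0(s - 1) \<Delta>\<close> (\<open>map_exponent_tilt\<close>). Inverting, \<open>F\<^sub>1(s)\<^sup>-\<^sup>1\<close> is the Laplace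
  transform of \<open>e\<^sup>x \<Delta>\<^sup>-\<^sup>1 W\<^sub>0(x) \<Delta>\<close>, because a shift in \<open>s\<close> is multiplication by \<open>e\<^sup>x\<close>
  (\<open>is_scale_function_similarity\<close>). Two facts make this an argument.
  
  The matrix \<open>\<Delta>\<close> has to be invertible, that is, the entries of \<open>v = (\<theta>I - T\<^sub>0)\<^sup>-\<^sup>1 t\<^sub>0\<close> must be nonzero
  (\<open>resolvent_exit_rates_pos\<close>). Here \<open>v\<^sub>i\<close> is the Laplace transform at \<open>\<theta>\<close> of the absorption time
  from \<open>i\<close>. A minimum principle gives \<open>v \<ge> 0\<close>, and the equation for \<open>v\<close> shows that the zeros of \<open>v\<close> form a
  set of states that the chain cannot leave. On such a set the transition probabilities sum to one, so
  along some cycle of length at most the number \<open>m\<close> of its states each step has probability at least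
  \<open>1 / m\<close>. Some return probability is then bounded below at arbitrarily large times, and the
  expected occupation times cannot all be finite (\<open>no_conservative_closed_class\<close>).
  
  Continuous functions have to be determined by their transforms (\<open>is_scale_function_unique\<close>).
  The transforms are Henstock-Kurzweil integrals, which may converge only conditionally. One
  integration by parts passes from \<open>f\<close> to the bounded continuous function
  \<open>g(x) = \<integral>\<^sub>0\<^sup>x e\<^sup>-\<^sup>\<sigma>\<^sup>y f(y) dy\<close>, which vanishes at infinity. All moments of \<open>g\<close> against powers of \<open>e\<^sup>-\<^sup>x\<close>
  vanish, and the Weierstrass theorem yields \<open>g = 0\<close>.
\<close>

section \<open>The matrix exponential\<close>

lemma mat_power_entry_bound:
  fixes A :: "real^'n^'n"
  shows "\<bar>mat_power A k $ i $ j\<bar> \<le> (\<Sum>i\<in>UNIV. \<Sum>j\<in>UNIV. \<bar>A $ i $ j\<bar>) ^ k"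
proof (induction k arbitrary: i)
  case 0
  show ?case by (simp add: mat_def)
next
  case (Suc k)
  let ?C = "\<Sum>i\<in>UNIV. \<Sum>j\<in>UNIV. \<bar>A $ i $ j\<bar>"
  have C: "0 \<le> ?C" by (intro sum_nonneg) auto
  have "\<bar>mat_power A (Suc k) $ i $ j\<bar> \<le> (\<Sum>l\<in>UNIV. \<bar>A $ i $ l\<bar> * \<bar>mat_power A k $ l $ j\<bar>)"
    by (auto simp: matrix_matrix_mult_def abs_mult intro!: order_trans[OF sum_abs])
  also have "\<dots> \<le> (\<Sum>l\<in>UNIV. \<bar>A $ i $ l\<bar>) * ?C ^ k"
    unfolding sum_distrib_right by (intro sum_mono mult_left_mono Suc.IH) auto
  also have "\<dots> \<le> ?C * ?C ^ k"
    by (intro mult_right_mono member_le_sum zero_le_power C) (auto intro: sum_nonneg)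
  finally show ?case by simp
qed

lemma summable_mat_exp_entry:
  fixes A :: "real^'n^'n"
  shows "summable (\<lambda>k. norm (mat_power A k $ i $ j / fact k))"
proof (rule summable_comparison_test')
  let ?C = "\<Sum>i\<in>UNIV. \<Sum>j\<in>UNIV. \<bar>A $ i $ j\<bar>"
  show "summable (\<lambda>k. inverse (fact k) * ?C ^ k)"
    by (rule summable_exp)
  show "norm (norm (mat_power A k $ i $ j / fact k)) \<le> inverse (fact k) * ?C ^ k" if "0 \<le> k" for k
    using mat_power_entry_bound[of A k i j] by (simp add: field_simps)
qed

lemma mat_exp_entry_sums:
  fixes A :: "real^'n^'n"
  shows "(\<lambda>k. mat_power A k $ i $ j / fact k) sums (mat_exp A $ i $ j)"
proof -
  define E :: "real^'n^'n" where "E = (\<chi> i j. \<Sum>k. mat_power A k $ i $ j / fact k)"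
  have E: "(\<lambda>k. mat_power A k $ i $ j / fact k) sums (E $ i $ j)" for i j
    using summable_sums[OF summable_norm_cancel[OF summable_mat_exp_entry[of A i j]]]
    by (simp add: E_def)
  have "(\<lambda>k. (1 / fact k) *\<^sub>R mat_power A k) sums E"
    unfolding sums_def
  proof (intro vec_tendstoI)
    fix i j
    show "((\<lambda>n. (\<Sum>k<n. (1 / fact k) *\<^sub>R mat_power A k) $ i $ j) \<longlongrightarrow> E $ i $ j) sequentially"
      using E[of i j] by (simp add: sums_def)
  qed
  then have "mat_exp A = E"
    unfolding mat_exp_def by (rule sums_unique[symmetric])
  with E show ?thesis by simp
qed

lemma matrix_add_rdistrib: "((A + B) :: real^'n^'m) ** (C :: real^'k^'n) = A ** C + B ** C"
  by (simp add: matrix_matrix_mult_def vec_eq_iff sum.distrib algebra_simps)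

lemma matrix_sum_ldistrib: "(A :: real^'n^'m) ** (\<Sum>i\<in>I. f i :: real^'k^'n) = (\<Sum>i\<in>I. A ** f i)"
  by (induction I rule: infinite_finite_induct) (auto simp: matrix_add_ldistrib)

text \<open>
  The binomial theorem for commuting matrices. Matrices of this type carry componentwise multiplication
  as their ring structure, so \<open>exp_series_add_commuting\<close> does not apply; the induction is the
  same.
\<close>

lemma mat_power_scaled_add_commuting:
  fixes A B :: "real^'n^'n"
  defines "S \<equiv> \<lambda>M k. mat_power M k /\<^sub>R fact k"
  assumes comm: "A ** B = B ** A"
  shows "S (A + B) n = (\<Sum>i\<le>n. S A i ** S B (n - i))"
proof (induction n)
  case 0
  show ?case by (simp add: S_def)
next
  case (Suc n)
  have times_S: "M ** S M k = real (Suc k) *\<^sub>R S M (Suc k)" for M :: "real^'n^'n" and k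
    by (simp add: S_def matrix_scalar_ac scalar_matrix_assoc [symmetric] del: mult_Suc of_nat_Suc)
  have "B ** mat_power A k = mat_power A k ** B" for k
    by (induction k) (auto simp: matrix_mul_assoc comm[symmetric], metis matrix_mul_assoc)
  then have S_comm: "B ** S A k = S A k ** B" for k
    by (simp add: S_def matrix_scalar_ac scalar_matrix_assoc [symmetric])
  have "real (Suc n) *\<^sub>R S (A + B) (Suc n) = (A + B) ** (\<Sum>i\<le>n. S A i ** S B (n - i))"
    by (metis Suc.IH times_S)
  also have "\<dots> = (\<Sum>i\<le>n. A ** S A i ** S B (n - i)) + (\<Sum>i\<le>n. S A i ** (B ** S B (n - i)))"
    by (simp add: matrix_add_rdistrib matrix_sum_ldistrib matrix_mul_assoc S_comm sum.distrib)
  also have "\<dots> = (\<Sum>i\<le>n. real (Suc i) *\<^sub>R (S A (Suc i) ** S B (n - i)))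
      + (\<Sum>i\<le>n. real (Suc n - i) *\<^sub>R (S A i ** S B (Suc n - i)))"
    by (simp add: times_S Suc_diff_le matrix_scalar_ac scalar_matrix_assoc [symmetric] del: of_nat_Suc)
  also have "(\<Sum>i\<le>n. real (Suc i) *\<^sub>R (S A (Suc i) ** S B (n - i)))
      = (\<Sum>i\<le>Suc n. real i *\<^sub>R (S A i ** S B (Suc n - i)))"
    by (subst sum.atMost_Suc_shift) simp
  also have "(\<Sum>i\<le>n. real (Suc n - i) *\<^sub>R (S A i ** S B (Suc n - i)))
      = (\<Sum>i\<le>Suc n. real (Suc n - i) *\<^sub>R (S A i ** S B (Suc n - i)))"
    by simp
  also have "(\<Sum>i\<le>Suc n. real i *\<^sub>R (S A i ** S B (Suc n - i)))
      + (\<Sum>i\<le>Suc n. real (Suc n - i) *\<^sub>R (S A i ** S B (Suc n - i)))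
      = (\<Sum>i\<le>Suc n. real (Suc n) *\<^sub>R (S A i ** S B (Suc n - i)))"
    by (simp flip: sum.distrib scaleR_add_left of_nat_add)
  also have "\<dots> = real (Suc n) *\<^sub>R (\<Sum>i\<le>Suc n. S A i ** S B (Suc n - i))"
    by (simp only: scaleR_right.sum)
  finally show ?case
    by (simp del: sum.cl_ivl_Suc)
qed

lemma mat_exp_add_commuting:
  fixes A B :: "real^'n^'n"
  assumes "A ** B = B ** A"
  shows "mat_exp (A + B) = mat_exp A ** mat_exp B"
proof -
  have "mat_exp (A + B) $ i $ j = (mat_exp A ** mat_exp B) $ i $ j" for i j
  proof -
    let ?S = "\<lambda>M k i j. mat_power M k $ i $ j / fact k"
    have "(\<lambda>n. \<Sum>k\<le>n. ?S A k i l * ?S B (n - k) l j) sums (mat_exp A $ i $ l * mat_exp B $ l $ j)" for l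
      using Cauchy_product_sums[OF summable_mat_exp_entry[of A i l] summable_mat_exp_entry[of B l j]]
        sums_unique[OF mat_exp_entry_sums[of A i l]] sums_unique[OF mat_exp_entry_sums[of B l j]]
      by simp
    then have "(\<lambda>n. \<Sum>l\<in>UNIV. \<Sum>k\<le>n. ?S A k i l * ?S B (n - k) l j) sums
        (\<Sum>l\<in>UNIV. mat_exp A $ i $ l * mat_exp B $ l $ j)"
      by (intro sums_sum)
    moreover have "?S (A + B) n i j = (\<Sum>l\<in>UNIV. \<Sum>k\<le>n. ?S A k i l * ?S B (n - k) l j)" for n
    proof -
      have "?S (A + B) n i j = (\<Sum>k\<le>n. \<Sum>l\<in>UNIV. ?S A k i l * ?S B (n - k) l j)"
        using arg_cong[OF mat_power_scaled_add_commuting[OF assms, of n], of "\<lambda>M. M $ i $ j"]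
        by (simp add: matrix_matrix_mult_def divide_inverse mult_ac)
      also have "\<dots> = (\<Sum>l\<in>UNIV. \<Sum>k\<le>n. ?S A k i l * ?S B (n - k) l j)"
        by (rule sum.swap)
      finally show ?thesis .
    qed
    ultimately have "(\<lambda>n. ?S (A + B) n i j) sums (mat_exp A ** mat_exp B) $ i $ j"
      by (simp add: matrix_matrix_mult_def)
    with mat_exp_entry_sums[of "A + B" i j] show ?thesis
      by (rule sums_unique2)
  qed
  then show ?thesis by (simp add: vec_eq_iff)
qed

lemma mat_exp_scalar: "mat_exp (c *\<^sub>R mat 1 :: real^'n^'n) = exp c *\<^sub>R mat 1"
proof -
  have pow: "mat_power (c *\<^sub>R mat 1 :: real^'n^'n) k = (c ^ k) *\<^sub>R mat 1" for k
    by (induction k) (auto simp: scalar_matrix_assoc [symmetric])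
  have "mat_exp (c *\<^sub>R mat 1 :: real^'n^'n) $ i $ j = (exp c *\<^sub>R mat 1 :: real^'n^'n) $ i $ j" for i j
  proof -
    have "(\<lambda>k. c ^ k /\<^sub>R fact k) sums exp c"
      by (rule exp_converges)
    from sums_mult2[OF this, of "(mat 1 :: real^'n^'n) $ i $ j"]
    have "(\<lambda>k. mat_power (c *\<^sub>R mat 1 :: real^'n^'n) k $ i $ j / fact k) sums
        (exp c *\<^sub>R mat 1 :: real^'n^'n) $ i $ j"
      by (simp add: pow field_simps)
    with mat_exp_entry_sums show ?thesis
      by (rule sums_unique2)
  qed
  then show ?thesis by (simp add: vec_eq_iff)
qed

text \<open>
  Adding a large multiple of the identity makes all entries of \<open>A\<close>, hence all terms of the
  exponential series, nonnegative, and it changes the exponential by a positive factor only.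
\<close>

lemma mat_exp_nonneg:
  fixes A :: "real^'n^'n"
  assumes "\<And>i j. i \<noteq> j \<Longrightarrow> 0 \<le> A $ i $ j"
  shows "0 \<le> mat_exp A $ i $ j"
proof -
  define c where "c = (\<Sum>i\<in>UNIV. \<bar>A $ i $ i\<bar>)"
  define Q where "Q = A + c *\<^sub>R mat 1"
  have "\<bar>A $ i $ i\<bar> \<le> c" for i
    unfolding c_def by (rule member_le_sum) auto
  then have "0 \<le> A $ i $ i + c" for i
    by (smt (verit))
  then have "0 \<le> Q $ i $ j" for i j
    using assms by (simp add: Q_def mat_def)
  then have "0 \<le> mat_power Q k $ i $ j" for k i j
    by (induction k arbitrary: i) (auto simp: mat_def matrix_matrix_mult_def intro!: sum_nonneg)
  then have Q: "0 \<le> mat_exp Q $ i $ j" for i j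
    using sums_le[OF _ sums_zero mat_exp_entry_sums[of Q i j]] by simp
  have "mat_exp A = mat_exp ((- c) *\<^sub>R mat 1 + Q)"
    by (simp add: Q_def)
  also have "\<dots> = mat_exp ((- c) *\<^sub>R mat 1) ** mat_exp Q"
    by (rule mat_exp_add_commuting)
      (simp only: scalar_matrix_assoc [symmetric] matrix_scalar_ac matrix_mul_lid matrix_mul_rid)
  also have "\<dots> = exp (- c) *\<^sub>R mat_exp Q"
    by (simp only: mat_exp_scalar scalar_matrix_assoc [symmetric] matrix_mul_lid)
  finally show ?thesis using Q by simp
qed

lemma mat_exp_semigroup:
  "mat_exp ((x + y) *\<^sub>R T) = mat_exp (x *\<^sub>R T) ** mat_exp (y *\<^sub>R (T :: real^'n^'n))"
  unfolding scaleR_add_left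
  by (rule mat_exp_add_commuting) (simp add: scalar_matrix_assoc [symmetric] matrix_scalar_ac mult.commute)

lemma mat_exp_0: "mat_exp (0 :: real^'n^'n) = mat 1"
  using mat_exp_scalar[of 0, where 'n = 'n] by simp

section \<open>Closed classes of transient chains\<close>

text \<open>
  The vector \<open>1\<^sub>Z\<close> lies in the kernel of the restriction of \<open>T\<close> to \<open>Z\<close>, and rows in \<open>Z\<close> see only
  the entries of a vector in \<open>Z\<close>. So only the constant term of the exponential series contributes:
  the chain started in a closed class without absorption stays there with probability one.
\<close>

lemma closed_class_row_sum:
  fixes T :: "real^'n^'n"
  assumes off: "\<And>i j. i \<in> Z \<Longrightarrow> j \<notin> Z \<Longrightarrow> T $ i $ j = 0"
    and rows: "\<And>i. i \<in> Z \<Longrightarrow> (\<Sum>j\<in>UNIV. T $ i $ j) = 0"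
    and "i \<in> Z"
  shows "(\<Sum>j\<in>Z. mat_exp (x *\<^sub>R T) $ i $ j) = 1"
proof -
  let ?P = "\<lambda>k i. \<Sum>j\<in>Z. mat_power (x *\<^sub>R T) k $ i $ j"
  have P: "?P k i = (if k = 0 then 1 else 0)" if "i \<in> Z" for k i
    using that
  proof (induction k arbitrary: i)
    case 0
    then show ?case by (simp add: mat_def)
  next
    case (Suc k)
    have "?P (Suc k) i = (\<Sum>l\<in>UNIV. x * T $ i $ l * ?P k l)"
      unfolding mat_power.simps sum_distrib_left by (subst sum.swap) (simp add: matrix_matrix_mult_def)
    also have "\<dots> = (\<Sum>l\<in>UNIV. x * T $ i $ l * (if k = 0 then 1 else 0))"
    proof (rule sum.cong[OF refl])
      fix l
      show "x * T $ i $ l * ?P k l = x * T $ i $ l * (if k = 0 then 1 else 0)"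
        by (cases "l \<in> Z") (simp_all add: Suc.IH off[OF Suc.prems])
    qed
    also have "\<dots> = 0"
      using rows[OF Suc.prems] by (simp add: sum_distrib_left [symmetric])
    finally show ?case by simp
  qed
  have "(\<lambda>k. \<Sum>j\<in>Z. mat_power (x *\<^sub>R T) k $ i $ j / fact k) sums (\<Sum>j\<in>Z. mat_exp (x *\<^sub>R T) $ i $ j)"
    by (intro sums_sum mat_exp_entry_sums)
  moreover have "(\<Sum>j\<in>Z. mat_power (x *\<^sub>R T) k $ i $ j / fact k) = (if k = 0 then 1 else 0)" for k
    using P[OF \<open>i \<in> Z\<close>, of k] by (simp add: sum_divide_distrib [symmetric])
  ultimately show ?thesis
    using sums_unique2[OF _ sums_single[of 0 "\<lambda>_. 1"]] by simp
qed

lemma periodic_point_in_finite_set: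
  assumes "finite Z" "Z \<noteq> {}" "f ` Z \<subseteq> Z"
  obtains i k where "i \<in> Z" "1 \<le> k" "k \<le> card Z" "(f ^^ k) i = i"
proof -
  obtain i0 where "i0 \<in> Z" using assms by blast
  have mem: "(f ^^ k) i0 \<in> Z" for k
    by (induction k) (use \<open>i0 \<in> Z\<close> assms in auto)
  have "\<not> inj_on (\<lambda>k. (f ^^ k) i0) {..card Z}"
    using card_inj_on_le[of "\<lambda>k. (f ^^ k) i0" "{..card Z}" Z] mem \<open>finite Z\<close> by auto
  then obtain a b where ab: "a < b" "b \<le> card Z" "(f ^^ a) i0 = (f ^^ b) i0"
    using linorder_inj_onI'[of "{..card Z}" "\<lambda>k. (f ^^ k) i0"] by auto
  have "(f ^^ (b - a)) ((f ^^ a) i0) = (f ^^ a) i0"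
    using ab funpow_add[of "b - a" a f] by simp
  with ab mem show ?thesis
    by (intro that[of "(f ^^ a) i0" "b - a"]) auto
qed

text \<open>
  Each state of \<open>Z\<close> has a successor in \<open>Z\<close> that is reached in time \<open>x\<close> with probability at least
  \<open>1 / card Z\<close>. Following these successors must lead to a cycle. The bound does not depend
  on \<open>x\<close>, which is what rules out integrable return probabilities.
\<close>

lemma return_probability_lower_bound:
  fixes T :: "real^'n^'n"
  assumes rates: "\<And>i j. i \<noteq> j \<Longrightarrow> 0 \<le> T $ i $ j"
    and off: "\<And>i j. i \<in> Z \<Longrightarrow> j \<notin> Z \<Longrightarrow> T $ i $ j = 0"
    and rows: "\<And>i. i \<in> Z \<Longrightarrow> (\<Sum>j\<in>UNIV. T $ i $ j) = 0"
    and "Z \<noteq> {}" "0 \<le> x"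
  shows "\<exists>i\<in>Z. \<exists>k\<in>{1..card Z}. (1 / card Z) ^ card Z \<le> mat_exp ((real k * x) *\<^sub>R T) $ i $ i"
proof -
  define P where "P y = mat_exp (y *\<^sub>R T)" for y
  define c where "c = 1 / real (card Z)"
  have card: "1 \<le> card Z" using \<open>Z \<noteq> {}\<close> by (simp add: Suc_le_eq card_gt_0_iff)
  then have c: "0 < c" "c \<le> 1" by (auto simp: c_def)
  have P_nonneg: "0 \<le> P y $ i $ j" if "0 \<le> y" for y i j
    unfolding P_def by (rule mat_exp_nonneg) (use rates that in auto)
  have "\<exists>j\<in>Z. c \<le> P x $ i $ j" if "i \<in> Z" for i
  proof (rule ccontr)
    assume "\<not> ?thesis"
    then have "(\<Sum>j\<in>Z. P x $ i $ j) < (\<Sum>j\<in>Z. c)"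
      using \<open>Z \<noteq> {}\<close> by (intro sum_strict_mono) auto
    then show False
      using closed_class_row_sum[OF off rows that, of x] \<open>Z \<noteq> {}\<close> by (simp add: P_def c_def)
  qed
  then obtain f where f: "\<And>i. i \<in> Z \<Longrightarrow> f i \<in> Z \<and> c \<le> P x $ i $ f i"
    by metis
  obtain i k where ik: "i \<in> Z" "1 \<le> k" "k \<le> card Z" "(f ^^ k) i = i"
    using periodic_point_in_finite_set[of Z f] f \<open>Z \<noteq> {}\<close> by auto
  \<comment> \<open>The probability of following \<open>f\<close> for \<open>l\<close> steps is a lower bound for that of reaching its endpoint.\<close>
  have "(f ^^ l) i \<in> Z \<and> c ^ l \<le> P (real l * x) $ i $ (f ^^ l) i" for l
  proof (induction l)
    case 0
    show ?case using ik by (simp add: P_def mat_exp_0 mat_def)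
  next
    case (Suc l)
    let ?a = "(f ^^ l) i"
    have "c ^ Suc l \<le> P (real l * x) $ i $ ?a * P x $ ?a $ f ?a"
      unfolding power_Suc2 using Suc f[of ?a] c \<open>0 \<le> x\<close> by (intro mult_mono P_nonneg) auto
    also have "\<dots> \<le> (\<Sum>m\<in>UNIV. P (real l * x) $ i $ m * P x $ m $ f ?a)"
      using \<open>0 \<le> x\<close> by (intro member_le_sum mult_nonneg_nonneg P_nonneg) auto
    also have "\<dots> = P (real (Suc l) * x) $ i $ f ?a"
      using mat_exp_semigroup[of "real l * x" x T]
      by (simp add: P_def matrix_matrix_mult_def algebra_simps)
    finally show ?case using Suc f by simp
  qed
  from this[of k] have "c ^ k \<le> P (real k * x) $ i $ i"
    using ik by simp
  moreover have "c ^ card Z \<le> c ^ k"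
    using c ik by (intro power_decreasing) auto
  ultimately show ?thesis
    using ik unfolding P_def c_def by (intro bexI[of _ i] bexI[of _ k]) auto
qed

text \<open>
  By \<open>return_probability_lower_bound\<close>, the sum of the functions \<open>x \<mapsto> P\<^sub>i\<^sub>i(kx)\<close> over \<open>i \<in> Z\<close>
  and \<open>1 \<le> k \<le> card Z\<close> is at least a positive constant everywhere. Transience makes the integral
  of each of them over \<open>[0, b]\<close> bounded in \<open>b\<close>.
\<close>

lemma no_conservative_closed_class:
  fixes T :: "real^'n^'n"
  assumes rates: "\<And>i j. i \<noteq> j \<Longrightarrow> 0 \<le> T $ i $ j"
    and trans: "\<And>i. transient_state T i"
    and off: "\<And>i j. i \<in> Z \<Longrightarrow> j \<notin> Z \<Longrightarrow> T $ i $ j = 0"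
    and rows: "\<And>i. i \<in> Z \<Longrightarrow> (\<Sum>j\<in>UNIV. T $ i $ j) = 0"
  shows "Z = {}"
proof (rule ccontr)
  assume Z: "Z \<noteq> {}"
  define p where "p i x = mat_exp (x *\<^sub>R T) $ i $ i" for i x
  define c where "c = (1 / real (card Z)) ^ card Z"
  have "0 < c" using Z by (simp add: c_def card_gt_0_iff)
  have p_nonneg: "0 \<le> p i x" if "0 \<le> x" for i x
    unfolding p_def by (rule mat_exp_nonneg) (use rates that in auto)
  have int: "p i integrable_on {0..}" for i
    using trans[of i] by (simp add: transient_state_def p_def[abs_def])
  have int_Icc: "p i integrable_on {0..b}" for i b
    by (rule integrable_on_subinterval[OF int]) auto
  have stretch: "(\<lambda>x. p i (real k * x)) integrable_on {0..b}"
      "integral {0..b} (\<lambda>x. p i (real k * x)) \<le> integral {0..} (p i)"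
    if "1 \<le> k" "0 \<le> b" for i k b
  proof -
    have "0 < real k" using that by simp
    have img: "(\<lambda>x. x / real k) ` {0..real k * b} = {0..b}"
      using \<open>0 < real k\<close> that by (simp add: image_divide_atLeastAtMost)
    have hi: "((\<lambda>x. p i (real k * x)) has_integral (1 / real k) *\<^sub>R integral {0..real k * b} (p i)) {0..b}"
      using has_integral_stretch_real[OF integrable_integral[OF int_Icc[of i "real k * b"]], of "real k"]
        \<open>0 < real k\<close> by (simp add: img)
    then show "(\<lambda>x. p i (real k * x)) integrable_on {0..b}" by blast
    have "integral {0..b} (\<lambda>x. p i (real k * x)) = (1 / real k) * integral {0..real k * b} (p i)"
      using hi by (simp add: integral_unique)
    also have "\<dots> \<le> 1 * integral {0..real k * b} (p i)"
      using that by (intro mult_right_mono integral_nonneg int_Icc p_nonneg) auto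
    also have "\<dots> \<le> integral {0..} (p i)"
      unfolding mult_1 by (rule integral_subset_le) (auto simp: int int_Icc p_nonneg)
    finally show "integral {0..b} (\<lambda>x. p i (real k * x)) \<le> integral {0..} (p i)" .
  qed
  define I where "I = (\<Sum>i\<in>Z. \<Sum>k=1..card Z. integral {0..} (p i))"
  have bound: "b * c \<le> I" if "0 \<le> b" for b
  proof -
    have "b * c = integral {0..b} (\<lambda>x. c)"
      using that by simp
    also have "\<dots> \<le> integral {0..b} (\<lambda>x. \<Sum>i\<in>Z. \<Sum>k=1..card Z. p i (real k * x))"
    proof (rule integral_le)
      show "(\<lambda>x. \<Sum>i\<in>Z. \<Sum>k=1..card Z. p i (real k * x)) integrable_on {0..b}"
        using that by (intro integrable_sum stretch) auto
      fix x assume x: "x \<in> {0..b}"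
      then obtain i k where ik: "i \<in> Z" "k \<in> {1..card Z}" "c \<le> p i (real k * x)"
        using return_probability_lower_bound[OF rates off rows Z, of x] unfolding c_def p_def by auto
      note ik(3)
      also have "p i (real k * x) \<le> (\<Sum>k=1..card Z. p i (real k * x))"
        using ik x by (intro member_le_sum p_nonneg) auto
      also have "\<dots> \<le> (\<Sum>i\<in>Z. \<Sum>k=1..card Z. p i (real k * x))"
        using ik x by (intro member_le_sum sum_nonneg p_nonneg) auto
      finally show "c \<le> (\<Sum>i\<in>Z. \<Sum>k=1..card Z. p i (real k * x))" .
    qed (rule integrable_const_ivl)
    also have "\<dots> = (\<Sum>i\<in>Z. \<Sum>k=1..card Z. integral {0..b} (\<lambda>x. p i (real k * x)))"
      using that by (intro integral_unique has_integral_sum integrable_integral stretch) auto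
    also have "\<dots> \<le> I"
      unfolding I_def using that by (intro sum_mono stretch) auto
    finally show ?thesis .
  qed
  \<comment> \<open>The integral of \<open>c\<close> over \<open>[0, (I + 1) / c]\<close> exceeds \<open>I\<close>; the bound at 0 gives \<open>0 \<le> I\<close>, so that this interval is proper.\<close>
  from bound[of 0] bound[of "(I + 1) / c"] \<open>0 < c\<close> show False by simp
qed

section \<open>Positivity of the transformed absorption times\<close>

lemma resolvent_equation_nth:
  fixes T :: "real^'n^'n"
  shows "((\<theta> *\<^sub>R mat 1 - T) *v v) $ i = \<theta> * v $ i - (\<Sum>j\<in>UNIV. T $ i $ j * v $ j)"
proof -
  have "((\<theta> *\<^sub>R mat 1 - T) *v v) $ i = (\<theta> *\<^sub>R v - T *v v) $ i"
    by (simp only: matrix_vector_mult_diff_rdistrib scaleR_matrix_vector_assoc [symmetric] matrix_vector_mul_lid)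
  then show ?thesis
    by (simp add: matrix_vector_mult_def)
qed

text \<open>
  A minimum principle: at a coordinate \<open>k\<close> where \<open>v\<close> attains a negative minimum, nonnegative rates and
  nonpositive row sums force \<open>(T v)\<^sub>k \<ge> 0\<close>, while \<open>\<theta> v\<^sub>k < 0\<close>.
\<close>

lemma resolvent_nonneg:
  fixes T :: "real^'n^'n"
  assumes T: "subintensity T" and "0 < \<theta>"
    and nonneg: "\<And>i. 0 \<le> ((\<theta> *\<^sub>R mat 1 - T) *v v) $ i"
  shows "0 \<le> v $ i"
proof -
  define m where "m = Min (range (($) v))"
  have m_le: "m \<le> v $ j" for j by (simp add: m_def)
  have "m \<in> range (($) v)" unfolding m_def by (rule Min_in) auto
  then obtain k where k: "v $ k = m" by (metis rangeE)
  show ?thesis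
  proof (rule ccontr)
    assume "\<not> 0 \<le> v $ i"
    then have "m < 0" using m_le[of i] by linarith
    have "T $ k $ j * m \<le> T $ k $ j * v $ j" for j
      using T k m_le[of j] unfolding subintensity_def
      by (cases "j = k") (simp_all add: mult_left_mono)
    then have "(\<Sum>j\<in>UNIV. T $ k $ j) * m \<le> (\<Sum>j\<in>UNIV. T $ k $ j * v $ j)"
      unfolding sum_distrib_right by (rule sum_mono)
    moreover have "0 \<le> (\<Sum>j\<in>UNIV. T $ k $ j) * m"
      using T \<open>m < 0\<close> unfolding subintensity_def by (intro mult_nonpos_nonpos) auto
    moreover have "(\<Sum>j\<in>UNIV. T $ k $ j * v $ j) \<le> \<theta> * m"
      using nonneg[of k] by (simp add: resolvent_equation_nth k)
    moreover have "\<theta> * m < 0"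
      using \<open>0 < \<theta>\<close> \<open>m < 0\<close> by (rule mult_pos_neg)
    ultimately show False by linarith
  qed
qed

text \<open>
  A vector in the kernel is nonnegative by \<open>resolvent_nonneg\<close>, and so is its negative.
\<close>

lemma invertible_resolvent:
  fixes T :: "real^'n^'n"
  assumes "subintensity T" "0 < \<theta>"
  shows "invertible (\<theta> *\<^sub>R mat 1 - T)"
proof -
  have "v = 0" if v: "(\<theta> *\<^sub>R mat 1 - T) *v v = 0" for v
  proof -
    have minus: "(\<theta> *\<^sub>R mat 1 - T) *v (- v) = 0"
      by (simp only: linear_neg[OF matrix_vector_mul_linear] v minus_zero)
    have "0 \<le> v $ i" for i
      by (rule resolvent_nonneg[OF assms]) (simp only: v zero_index order_refl)
    moreover have "0 \<le> (- v) $ i" for i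
      by (rule resolvent_nonneg[OF assms]) (simp only: minus zero_index order_refl)
    ultimately have "v $ i = 0" for i
      by (simp add: order_antisym)
    then show "v = 0" by (simp add: vec_eq_iff)
  qed
  then show ?thesis
    by (simp only: invertible_left_inverse matrix_left_invertible_ker) blast
qed

lemma
  fixes A :: "real^'n^'n"
  assumes "invertible A"
  shows matrix_inv_right: "A ** matrix_inv A = mat 1"
    and matrix_inv_left: "matrix_inv A ** A = mat 1"
  using someI_ex[OF assms[unfolded invertible_def]] by (simp_all only: matrix_inv_def)

lemma matrix_inv_eqI:
  fixes A :: "real^'n^'n"
  assumes "A ** B = mat 1"
  shows "matrix_inv A = B"
proof -
  have "B ** A = mat 1" using assms by (simp only: matrix_left_right_inverse)
  then have "invertible A" using assms unfolding invertible_def by blast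
  then have "matrix_inv A ** (A ** B) = B"
    by (simp add: matrix_mul_assoc matrix_inv_left)
  then show ?thesis by (simp add: assms)
qed

text \<open>
  Where \<open>v\<close> vanishes, \<open>\<theta> v\<^sub>i = t\<^sub>i + \<Sum>\<^sub>j T\<^sub>i\<^sub>j v\<^sub>j\<close> is a vanishing sum of nonnegative terms: there is no
  absorption from \<open>i\<close> and no transition to a state with \<open>v\<^sub>j > 0\<close>. A transient chain has no
  nonempty set of such states.
\<close>

lemma resolvent_exit_rates_pos:
  fixes T :: "real^'n^'n"
  assumes ph: "phase_type T \<nu> t" and "0 < \<theta>"
  shows "0 < (matrix_inv (\<theta> *\<^sub>R mat 1 - T) *v t) $ i"
proof -
  define v where "v = matrix_inv (\<theta> *\<^sub>R mat 1 - T) *v t"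
  have T: "subintensity T" and trans: "\<And>i. transient_state T i" and t: "t = exit_rates T"
    using ph by (auto simp: phase_type_def)
  have off: "0 \<le> T $ i $ j" if "i \<noteq> j" for i j
    using T that by (auto simp: subintensity_def)
  have t_nth: "t $ i = - (\<Sum>j\<in>UNIV. T $ i $ j)" for i
    by (simp add: t exit_rates_def matrix_vector_mult_def)
  then have t_nonneg: "0 \<le> t $ i" for i
    using T by (simp add: subintensity_def)
  have "(\<theta> *\<^sub>R mat 1 - T) *v v = t"
    using matrix_inv_right[OF invertible_resolvent[OF T \<open>0 < \<theta>\<close>]]
    by (simp add: v_def matrix_vector_mul_assoc)
  then have v_nonneg: "0 \<le> v $ i"
      and v_eq: "\<theta> * v $ i = t $ i + (\<Sum>j\<in>UNIV. T $ i $ j * v $ j)" for i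
    using resolvent_nonneg[OF T \<open>0 < \<theta>\<close>, of v] t_nonneg resolvent_equation_nth[of \<theta> T v i]
    by (auto simp: vec_eq_iff)
  define Z where "Z = {i. v $ i = 0}"
  have Z: "t $ i = 0" "\<And>j. T $ i $ j * v $ j = 0" if "i \<in> Z" for i
  proof -
    have vi: "v $ i = 0" using that by (simp add: Z_def)
    then have nonneg: "0 \<le> T $ i $ j * v $ j" for j
      by (cases "i = j") (auto intro: mult_nonneg_nonneg off v_nonneg)
    have "t $ i + (\<Sum>j\<in>UNIV. T $ i $ j * v $ j) = 0"
      using v_eq[of i] vi by simp
    moreover have "0 \<le> (\<Sum>j\<in>UNIV. T $ i $ j * v $ j)"
      by (rule sum_nonneg) (rule nonneg)
    ultimately have "t $ i = 0 \<and> (\<Sum>j\<in>UNIV. T $ i $ j * v $ j) = 0"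
      using t_nonneg[of i] by linarith
    then show "t $ i = 0" "T $ i $ j * v $ j = 0" for j
      using nonneg by (auto simp: sum_nonneg_eq_0_iff)
  qed
  have "Z = {}"
  proof (rule no_conservative_closed_class[OF off trans])
    show "T $ i $ j = 0" if "i \<in> Z" "j \<notin> Z" for i j
      using Z(2)[OF that(1), of j] that(2) by (simp add: Z_def)
    show "(\<Sum>j\<in>UNIV. T $ i $ j) = 0" if "i \<in> Z" for i
      using Z(1)[OF that] t_nth[of i] by simp
  qed
  then have "v $ i \<noteq> 0" by (auto simp: Z_def)
  with v_nonneg[of i] show ?thesis by (simp add: v_def)
qed

lemma inner_probability_vector_pos:
  fixes \<nu> v :: "real^'n"
  assumes \<nu>: "probability_vector \<nu>" and v: "\<And>i. 0 < v $ i"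
  shows "0 < \<nu> \<bullet> v"
proof -
  have nonneg: "0 \<le> \<nu> $ i" for i using \<nu> by (simp add: probability_vector_def)
  have "(\<Sum>i\<in>UNIV. \<nu> $ i) \<noteq> 0" using \<nu> by (simp add: probability_vector_def)
  then obtain k where "\<nu> $ k \<noteq> 0" using sum.neutral[of UNIV "\<lambda>i. \<nu> $ i"] by blast
  with nonneg[of k] have "0 < \<nu> $ k" by simp
  then show ?thesis
    unfolding inner_vec_def inner_real_def
    by (intro sum_pos2[of _ k]) (auto intro: mult_pos_pos mult_nonneg_nonneg nonneg less_imp_le[OF v] v)
qed

lemma invertible_diag_mat:
  fixes v :: "real^'n"
  assumes "\<And>i. v $ i \<noteq> 0"
  shows "invertible (diag_mat v)"
proof -
  have "diag_mat v ** diag_mat (\<chi> i. 1 / v $ i) = mat 1"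
    using assms by (simp add: vec_eq_iff diag_mat_def mat_def matrix_matrix_mult_def
        if_distrib[where f = "\<lambda>x. x * _"] cong: if_cong)
  then show ?thesis
    unfolding invertible_right_inverse by blast
qed

section \<open>Uniqueness of Laplace transforms\<close>

text \<open>
  Limits of integrals over \<open>[0, b]\<close> replace the integral over the half line below: they
  are easy to manipulate when the convergence is not absolute.
\<close>

lemma integral_tendsto_at_top:
  fixes f :: "real \<Rightarrow> real"
  assumes "(f has_integral I) {0..}"
  shows "((\<lambda>b. integral {0..b} f) \<longlongrightarrow> I) at_top"
proof (rule tendstoI)
  fix e :: real assume "0 < e"
  let ?f0 = "\<lambda>x. if x \<in> {0..} then f x else 0"
  from assms \<open>0 < e\<close> obtain C where C: "C > 0"
    "\<And>a b. ball 0 C \<subseteq> cbox a b \<Longrightarrow> norm (integral (cbox a b) ?f0 - I) < e"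
    unfolding has_integral_alt'[of f I] by blast
  show "\<forall>\<^sub>F b in at_top. dist (integral {0..b} f) I < e"
    unfolding eventually_at_top_linorder
  proof (intro exI allI impI)
    fix b assume "C \<le> b"
    then have "ball (0::real) C \<subseteq> cbox (- b) b"
      by (auto simp: dist_real_def)
    then have "norm (integral (cbox (- b) b) ?f0 - I) < e"
      by (rule C(2))
    moreover have "integral (cbox (- b) b) ?f0 = integral ({0..} \<inter> cbox (- b) b) f"
      by (rule integral_restrict_Int)
    moreover have "{0..} \<inter> cbox (- b) b = {0..b}"
      using \<open>0 < C\<close> \<open>C \<le> b\<close> by auto
    ultimately show "dist (integral {0..b} f) I < e"
      by (simp only: dist_norm)
  qed
qed

text \<open>
  In the variable \<open>y = e\<^sup>-\<^sup>x\<close> the function \<open>g\<close> becomes a continuous function \<open>h\<close> on \<open>[0, 1]\<close>, with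
  \<open>h(0) = 0\<close>, and is uniformly close to a polynomial in \<open>e\<^sup>-\<^sup>x\<close>. The moments say that \<open>g\<close> is orthogonal to
  these polynomials for the weight \<open>e\<^sup>-\<^sup>x\<close>, so the weighted integral of \<open>g\<^sup>2\<close> is arbitrarily small.
\<close>

lemma vanishing_exponential_moments:
  fixes g :: "real \<Rightarrow> real"
  assumes cont: "continuous_on {0..} g"
    and lim: "(g \<longlongrightarrow> 0) at_top"
    and moments: "\<And>k::nat. ((\<lambda>b. integral {0..b} (\<lambda>x. exp (- real (Suc k) * x) * g x)) \<longlongrightarrow> 0) at_top"
    and "0 \<le> x"
  shows "g x = 0"
proof -
  define h where "h y = (if y \<le> 0 then 0 else g (- ln y))" for y :: real
  have h_exp: "h (exp (- x)) = g x" for x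
    by (simp add: h_def)
  have h_cont: "continuous_on {0..1} h"
    unfolding continuous_on_eq_continuous_within
  proof
    fix y :: real assume y: "y \<in> {0..1}"
    show "continuous (at y within {0..1}) h"
    proof (cases "y = 0")
      case True
      have "filterlim (\<lambda>y::real. - ln y) at_top (at_right 0)"
        using ln_at_0 by (simp add: filterlim_uminus_at_top)
      from filterlim_compose[OF lim this] have "((\<lambda>y. g (- ln y)) \<longlongrightarrow> 0) (at_right 0)" .
      then have "(h \<longlongrightarrow> 0) (at_right 0)"
        by (rule Lim_transform_eventually)
           (auto simp: h_def eventually_at_right_less intro!: eventually_mono[OF eventually_at_right_less])
      then have "(h \<longlongrightarrow> 0) (at 0 within {0..1})"
        by (simp add: at_within_Icc_at_right)
      then show ?thesis
        by (simp add: True continuous_within h_def)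
    next
      case False
      with y have "0 < y" by simp
      have "continuous_on {0<..1} (\<lambda>y. g (- ln y))"
        by (rule continuous_on_compose2[OF cont]) (auto intro!: continuous_intros)
      then have "continuous_on {0<..1} h"
        by (rule continuous_on_eq) (auto simp: h_def)
      then have "continuous (at y within {0<..1}) h"
        using y \<open>0 < y\<close> by (simp add: continuous_on_eq_continuous_within)
      moreover have "at y within {0<..1} = at y within {0..1}"
        by (rule at_within_nhd[where S = "{0<..}"]) (use \<open>0 < y\<close> in auto)
      ultimately show ?thesis
        by (simp add: continuous_within)
    qed
  qed
  then have "bounded (h ` {0..1})"
    by (intro compact_imp_bounded compact_continuous_image) auto
  then obtain M where M: "0 < M" "\<And>y. y \<in> {0..1} \<Longrightarrow> \<bar>h y\<bar> \<le> M"
    unfolding bounded_pos by auto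
  have g_le: "\<bar>g x\<bar> \<le> M" if "0 \<le> x" for x
    using M(2)[of "exp (- x)"] that by (simp add: h_exp)
  have cont_Icc: "continuous_on {0..b} g" for b
    by (rule continuous_on_subset[OF cont]) auto
  have sq_int: "(\<lambda>x. exp (- x) * (g x)\<^sup>2) integrable_on {0..b}" for b
    by (intro integrable_continuous_interval continuous_intros cont_Icc)
  \<comment> \<open>The integral of \<open>g\<^sup>2\<close> differs from that of \<open>g p(e\<^sup>-\<^sup>x)\<close>, which tends to 0, by at most \<open>e M\<close>, the total weight being 1.\<close>
  have small: "integral {0..a} (\<lambda>x. exp (- x) * (g x)\<^sup>2) \<le> e * M" if "0 < e" for a e
  proof -
    obtain p where p: "real_polynomial_function p" "\<And>y. y \<in> {0..1} \<Longrightarrow> \<bar>h y - p y\<bar> < e"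
      using Stone_Weierstrass_real_polynomial_function[OF _ h_cont \<open>0 < e\<close>] by blast
    then obtain c N where c: "p = (\<lambda>y. \<Sum>i\<le>N. c i * y ^ i)"
      unfolding real_polynomial_function_iff_sum by blast
    have p_exp: "exp (- x) * (g x * p (exp (- x))) = (\<Sum>i\<le>N. c i * (exp (- real (Suc i) * x) * g x))" for x
      by (simp add: c sum_distrib_left exp_of_nat_mult[symmetric] algebra_simps flip: exp_add)
    have mom_int: "(\<lambda>x. exp (- real (Suc i) * x) * g x) integrable_on {0..b}" for i b
      by (intro integrable_continuous_interval continuous_intros cont_Icc)
    have "((\<lambda>b. \<Sum>i\<le>N. c i * integral {0..b} (\<lambda>x. exp (- real (Suc i) * x) * g x)) \<longlongrightarrow> (\<Sum>i\<le>N. c i * 0)) at_top"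
      by (intro tendsto_intros moments)
    moreover have "integral {0..b} (\<lambda>x. exp (- x) * (g x * p (exp (- x))))
        = (\<Sum>i\<le>N. c i * integral {0..b} (\<lambda>x. exp (- real (Suc i) * x) * g x))" for b
      unfolding p_exp
      by (subst integral_sum) (simp_all only: finite_atMost integral_mult_right integrable_on_mult_right mom_int)
    ultimately have lim0: "((\<lambda>b. integral {0..b} (\<lambda>x. exp (- x) * (g x * p (exp (- x))))) \<longlongrightarrow> 0) at_top"
      by simp
    have le: "integral {0..a} (\<lambda>x. exp (- x) * (g x)\<^sup>2)
        \<le> integral {0..b} (\<lambda>x. exp (- x) * (g x * p (exp (- x)))) + e * M" if "max 0 a \<le> b" for b
    proof -
      have "integral {0..a} (\<lambda>x. exp (- x) * (g x)\<^sup>2) \<le> integral {0..b} (\<lambda>x. exp (- x) * (g x)\<^sup>2)"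
        by (rule integral_subset_le) (use that sq_int in auto)
      also have "\<dots> \<le> integral {0..b} (\<lambda>x. exp (- x) * (g x * p (exp (- x))) + e * M * exp (- x))"
      proof (rule integral_le[OF sq_int])
        show "(\<lambda>x. exp (- x) * (g x * p (exp (- x))) + e * M * exp (- x)) integrable_on {0..b}"
          unfolding c by (intro integrable_continuous_interval continuous_intros cont_Icc)
        fix x assume x: "x \<in> {0..b}"
        then have "\<bar>g x - p (exp (- x))\<bar> \<le> e"
          using p(2)[of "exp (- x)"] by (simp add: h_exp)
        then have "\<bar>g x * (g x - p (exp (- x)))\<bar> \<le> M * e"
          unfolding abs_mult using x \<open>0 < M\<close> by (intro mult_mono g_le) auto
        then have "(g x)\<^sup>2 \<le> g x * p (exp (- x)) + e * M"
          by (simp add: algebra_simps power2_eq_square)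
        from mult_left_mono[OF this, of "exp (- x)"]
        show "exp (- x) * (g x)\<^sup>2 \<le> exp (- x) * (g x * p (exp (- x))) + e * M * exp (- x)"
          by (simp add: algebra_simps)
      qed
      also have "\<dots> = integral {0..b} (\<lambda>x. exp (- x) * (g x * p (exp (- x))))
          + e * M * integral {0..b} (\<lambda>x. exp (- x))"
        unfolding c by (subst integral_add)
          (auto intro!: integrable_continuous_interval continuous_intros cont_Icc)
      also have "integral {0..b} (\<lambda>x. exp (- x)) \<le> integral {0..} (\<lambda>x::real. exp (- x))"
        by (rule integral_subset_le)
          (use integrable_on_exp_minus_to_infinity[of 1 0] in
            \<open>auto intro!: integrable_continuous_interval continuous_intros\<close>)
      also have "\<dots> = 1"
        using has_integral_exp_minus_to_infinity[of 1 0] by (simp add: integral_unique)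
      finally show ?thesis
        using \<open>0 < e\<close> \<open>0 < M\<close> by (simp add: mult_left_mono)
    qed
    have "integral {0..a} (\<lambda>x. exp (- x) * (g x)\<^sup>2) \<le> 0 + e * M"
      by (rule tendsto_lowerbound[OF tendsto_add[OF lim0 tendsto_const]])
         (auto intro!: eventually_mono[OF eventually_ge_at_top[of "max 0 a"]] le)
    then show ?thesis by simp
  qed
  have "integral {0..x + 1} (\<lambda>x. exp (- x) * (g x)\<^sup>2) \<le> 0"
  proof (rule field_le_epsilon)
    fix e :: real assume "0 < e"
    then show "integral {0..x + 1} (\<lambda>x. exp (- x) * (g x)\<^sup>2) \<le> 0 + e"
      using small[of "e / M" "x + 1"] \<open>0 < M\<close> by simp
  qed
  moreover have "0 \<le> integral {0..x + 1} (\<lambda>x. exp (- x) * (g x)\<^sup>2)"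
    by (rule integral_nonneg[OF sq_int]) auto
  ultimately have "((\<lambda>x. exp (- x) * (g x)\<^sup>2) has_integral 0) (cbox 0 (x + 1))"
    using sq_int[of "x + 1"] by (metis antisym box_real(2) integrable_integral)
  moreover have "continuous_on (cbox 0 (x + 1)) (\<lambda>x. exp (- x) * (g x)\<^sup>2)"
    unfolding box_real by (intro continuous_intros cont_Icc)
  ultimately have "exp (- x) * (g x)\<^sup>2 = 0"
    using \<open>0 \<le> x\<close> by (intro has_integral_0_cbox_imp_0[of 0 "x + 1"]) auto
  then show ?thesis by simp
qed

text \<open>
  For \<open>u > 0\<close> integration by parts gives \<open>\<integral>\<^sub>0\<^sup>b e\<^sup>-\<^sup>(\<^sup>\<sigma>\<^sup>+\<^sup>u\<^sup>)\<^sup>x f(x) dx = e\<^sup>-\<^sup>u\<^sup>b g(b) + u \<integral>\<^sub>0\<^sup>b e\<^sup>-\<^sup>u\<^sup>x g(x) dx\<close>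
  for the primitive \<open>g\<close> of \<open>e\<^sup>-\<^sup>\<sigma>\<^sup>x f(x)\<close>. Unlike \<open>f\<close>, the function \<open>g\<close> tends to 0 at infinity because
  the integral defining the transform converges, with value 0, at \<open>\<sigma>\<close> itself. So \<open>g\<close> has vanishing moments, and
  differentiating \<open>g = 0\<close> gives the claim.
\<close>

lemma Laplace_transform_zero_imp_zero:
  fixes f :: "real \<Rightarrow> real"
  assumes cont: "continuous_on {0..} f"
    and transf: "\<forall>\<^sub>F s in at_top. ((\<lambda>x. exp (- s * x) * f x) has_integral 0) {0..}"
    and "0 \<le> x"
  shows "f x = 0"
proof -
  obtain \<sigma> where \<sigma>: "\<And>s. \<sigma> \<le> s \<Longrightarrow> ((\<lambda>x. exp (- s * x) * f x) has_integral 0) {0..}"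
    using transf unfolding eventually_at_top_linorder by blast
  define w where "w x = exp (- \<sigma> * x) * f x" for x
  define g where "g x = integral {0..x} w" for x
  have w_cont: "continuous_on {0..} w"
    unfolding w_def by (intro continuous_intros cont)
  have w_cont_Icc: "continuous_on {0..b} w" for b
    by (rule continuous_on_subset[OF w_cont]) auto
  have g_deriv: "(g has_vector_derivative w x) (at x within {0..b})" if "x \<in> {0..b}" for x b
    unfolding g_def using integral_has_vector_derivative[OF w_cont_Icc that] .
  have g_cont_Icc: "continuous_on {0..b} g" for b
    unfolding continuous_on_eq_continuous_within
    using g_deriv has_vector_derivative_continuous by blast
  have g_cont: "continuous_on {0..} g"
    unfolding continuous_on_eq_continuous_within
  proof
    fix y :: real assume y: "y \<in> {0..}"
    have "continuous (at y within {0..y + 1}) g"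
      using g_cont_Icc[of "y + 1"] y by (simp add: continuous_on_eq_continuous_within)
    moreover have "at y within {0..y + 1} = at y within {0..}"
      by (rule at_within_nhd[where S = "{..<y + 1}"]) auto
    ultimately show "continuous (at y within {0..}) g"
      by (simp add: continuous_within)
  qed
  have g_lim: "(g \<longlongrightarrow> 0) at_top"
    unfolding g_def using integral_tendsto_at_top[OF \<sigma>[of \<sigma>]] by (simp add: w_def[abs_def])
  have "((\<lambda>b. integral {0..b} (\<lambda>x. exp (- real (Suc k) * x) * g x)) \<longlongrightarrow> 0) at_top" for k
  proof -
    define u where "u = real (Suc k)"
    have "0 < u" by (simp add: u_def)
    have parts: "integral {0..b} (\<lambda>x. exp (- u * x) * g x)
        = (integral {0..b} (\<lambda>x. exp (- (\<sigma> + u) * x) * f x) - exp (- u * b) * g b) / u"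
      if "0 \<le> b" for b
    proof -
      have "((\<lambda>x. exp (- u * x) * w x + (- u * exp (- u * x)) * g x) has_integral
          exp (- u * b) * g b - exp (- u * 0) * g 0) {0..b}"
      proof (rule fundamental_theorem_of_calculus[OF that])
        fix x assume x: "x \<in> {0..b}"
        have "((\<lambda>x. exp (- u * x)) has_vector_derivative - u * exp (- u * x)) (at x within {0..b})"
          unfolding has_real_derivative_iff_has_vector_derivative [symmetric]
          by (auto intro!: derivative_eq_intros)
        from has_vector_derivative_mult[OF this g_deriv[OF x]]
        show "((\<lambda>x. exp (- u * x) * g x) has_vector_derivative
            exp (- u * x) * w x + (- u * exp (- u * x)) * g x) (at x within {0..b})" .
      qed
      moreover have "g 0 = 0" by (simp add: g_def)
      moreover have "integral {0..b} (\<lambda>x. exp (- u * x) * w x + (- u * exp (- u * x)) * g x)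
          = integral {0..b} (\<lambda>x. exp (- u * x) * w x) + - u * integral {0..b} (\<lambda>x. exp (- u * x) * g x)"
        unfolding mult.assoc integral_mult_right[symmetric]
        by (rule integral_add)
          (intro integrable_continuous_interval continuous_intros w_cont_Icc g_cont_Icc)+
      moreover have "(\<lambda>x. exp (- u * x) * w x) = (\<lambda>x. exp (- (\<sigma> + u) * x) * f x)"
        by (simp add: w_def fun_eq_iff algebra_simps flip: exp_add)
      ultimately show ?thesis
        using \<open>0 < u\<close> by (simp add: integral_unique field_simps)
    qed
    have "((\<lambda>b. exp (- u * b)) \<longlongrightarrow> 0) at_top"
      using \<open>0 < u\<close>
      by (intro filterlim_compose[OF exp_at_bot] filterlim_tendsto_neg_mult_at_bot[OF tendsto_const]
          filterlim_ident) simp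
    then have "((\<lambda>b. (integral {0..b} (\<lambda>x. exp (- (\<sigma> + u) * x) * f x) - exp (- u * b) * g b) / u)
        \<longlongrightarrow> (0 - 0 * 0) / u) at_top"
      using \<open>0 < u\<close> by (intro tendsto_intros integral_tendsto_at_top \<sigma> g_lim) auto
    then have "((\<lambda>b. integral {0..b} (\<lambda>x. exp (- u * x) * g x)) \<longlongrightarrow> (0 - 0 * 0) / u) at_top"
      by (rule Lim_transform_eventually)
         (rule eventually_mono[OF eventually_ge_at_top[of 0]], simp only: parts)
    then show ?thesis
      by (simp add: u_def)
  qed
  then have g0: "g y = 0" if "0 \<le> y" for y
    using vanishing_exponential_moments[OF g_cont g_lim _ that] by blast
  have "((\<lambda>_. 0) has_vector_derivative w x) (at x within {0..x + 1})"
    by (rule has_vector_derivative_transform[OF _ _ g_deriv]) (use \<open>0 \<le> x\<close> g0 in auto)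
  moreover have "((\<lambda>_. 0) has_vector_derivative 0) (at x within {0..x + 1})"
    by (rule has_vector_derivative_const)
  ultimately have "w x = 0"
    by (rule vector_derivative_unique_within[rotated])
       (use \<open>0 \<le> x\<close> in \<open>auto simp: trivial_limit_within islimpt_Icc\<close>)
  then show ?thesis
    by (simp add: w_def)
qed

section \<open>Scale functions under conjugation and shift\<close>

text \<open>
  The identity \<open>G\<^sup>s / G = G\<^sup>s\<^sup>-\<^sup>1\<close>, where \<open>G\<^sup>s = e\<^sup>-\<^sup>d\<^sup>s\<close> for \<open>d = - ln G\<close>, moves the normalisation of \<open>\<nu>\<close> into the shift, and
  the shift of the drift term produces \<open>- \<theta>\<close>.
\<close>

lemma map_exponent_tilt:
  fixes T D :: "real^'n^'n"
  assumes D: "invertible D" and "0 < G"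
  shows "map_exponent (matrix_inv D ** T ** D - \<theta> *\<^sub>R mat 1) ((1 / G) *\<^sub>R (\<nu> v* D)) (matrix_inv D *v t) \<theta> (- ln G) s
    = matrix_inv D ** map_exponent T \<nu> t \<theta> (- ln G) (s - 1) ** D"
proof -
  let ?R = "(columnvector t :: real^1^'n) ** (rowvector \<nu> :: real^'n^1)"
  have "(columnvector (matrix_inv D *v t) :: real^1^'n) ** (rowvector ((1 / G) *\<^sub>R (\<nu> v* D)) :: real^'n^1)
      = (1 / G) *\<^sub>R (matrix_inv D ** ?R ** D)"
  proof -
    have "(rowvector ((1 / G) *\<^sub>R (\<nu> v* D)) :: real^'n^1) = (1 / G) *\<^sub>R (rowvector \<nu> ** D)"
      by (simp add: vec_eq_iff rowvector_def vector_matrix_mult_def matrix_matrix_mult_def mult.commute)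
    then show ?thesis
      by (simp add: dot_rowvector_columnvector matrix_scalar_ac matrix_mul_assoc scalar_matrix_assoc [symmetric])
  qed
  then have "map_exponent (matrix_inv D ** T ** D - \<theta> *\<^sub>R mat 1) ((1 / G) *\<^sub>R (\<nu> v* D)) (matrix_inv D *v t) \<theta> (- ln G) s
      = matrix_inv D ** T ** D - \<theta> *\<^sub>R mat 1 + (\<theta> * s) *\<^sub>R mat 1
        + (exp (ln G * s) * (1 / G)) *\<^sub>R (matrix_inv D ** ?R ** D)"
    by (simp add: map_exponent_def)
  also have "\<dots> = matrix_inv D ** T ** D + (\<theta> * (s - 1)) *\<^sub>R mat 1
        + exp (ln G * (s - 1)) *\<^sub>R (matrix_inv D ** ?R ** D)"
    using \<open>0 < G\<close> by (simp add: algebra_simps exp_diff)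
  also have "\<dots> = matrix_inv D ** map_exponent T \<nu> t \<theta> (- ln G) (s - 1) ** D"
    by (simp only: map_exponent_def matrix_add_ldistrib matrix_add_rdistrib matrix_scalar_ac
        scalar_matrix_assoc [symmetric] matrix_mul_rid matrix_inv_left[OF D] minus_minus)
  finally show ?thesis .
qed

lemma bounded_linear_similarity:
  fixes D E :: "real^'n^'n"
  shows "bounded_linear (\<lambda>M. D ** M ** E)"
  unfolding linear_conv_bounded_linear [symmetric]
  by (rule linearI)
    (simp_all add: matrix_add_ldistrib matrix_add_rdistrib matrix_scalar_ac scalar_matrix_assoc [symmetric])

text \<open>
  Conjugation is linear, so it commutes with the Laplace transform, and it commutes with matrix
  inversion; the factor \<open>e\<^sup>x\<close> accounts for the shift of \<open>s\<close>.
\<close>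

lemma is_scale_function_similarity:
  fixes D :: "real^'n^'n"
  assumes D: "invertible D" and W: "is_scale_function F W"
  shows "is_scale_function (\<lambda>s. matrix_inv D ** F (s - 1) ** D) (\<lambda>x. exp x *\<^sub>R (matrix_inv D ** W x ** D))"
proof -
  let ?L = "\<lambda>M. matrix_inv D ** M ** D"
  have L: "bounded_linear ?L" by (rule bounded_linear_similarity)
  have "continuous_on {0..} W" using W by (simp add: is_scale_function_def)
  then have cont: "continuous_on {0..} (\<lambda>x. exp x *\<^sub>R ?L (W x))"
    by (intro continuous_intros bounded_linear.continuous_on[OF L])
  obtain \<sigma> where \<sigma>: "\<And>s. \<sigma> \<le> s \<Longrightarrow> invertible (F s)"
      "\<And>s. \<sigma> \<le> s \<Longrightarrow> ((\<lambda>x. exp (- s * x) *\<^sub>R W x) has_integral matrix_inv (F s)) {0..}"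
    using W unfolding is_scale_function_def eventually_at_top_linorder by blast
  have "invertible (?L (F (s - 1))) \<and>
      ((\<lambda>x. exp (- s * x) *\<^sub>R (exp x *\<^sub>R ?L (W x))) has_integral matrix_inv (?L (F (s - 1)))) {0..}"
    if "\<sigma> + 1 \<le> s" for s
  proof -
    have s: "\<sigma> \<le> s - 1" using that by simp
    have "?L (F (s - 1)) ** ?L (matrix_inv (F (s - 1)))
        = matrix_inv D ** F (s - 1) ** (D ** matrix_inv D) ** matrix_inv (F (s - 1)) ** D"
      by (simp only: matrix_mul_assoc)
    also have "\<dots> = matrix_inv D ** (F (s - 1) ** matrix_inv (F (s - 1))) ** D"
      by (simp only: matrix_inv_right[OF D] matrix_mul_rid matrix_mul_assoc)
    also have "\<dots> = mat 1"
      by (simp only: matrix_inv_right[OF \<sigma>(1)[OF s]] matrix_mul_rid matrix_inv_left[OF D])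
    finally have inv: "?L (F (s - 1)) ** ?L (matrix_inv (F (s - 1))) = mat 1" .
    have "(?L \<circ> (\<lambda>x. exp (- (s - 1) * x) *\<^sub>R W x) has_integral ?L (matrix_inv (F (s - 1)))) {0..}"
      by (rule has_integral_linear[OF \<sigma>(2)[OF s] L])
    moreover have "?L \<circ> (\<lambda>x. exp (- (s - 1) * x) *\<^sub>R W x) = (\<lambda>x. exp (- s * x) *\<^sub>R (exp x *\<^sub>R ?L (W x)))"
      by (simp add: fun_eq_iff matrix_scalar_ac scalar_matrix_assoc [symmetric] algebra_simps flip: exp_add)
    ultimately show ?thesis
      using inv unfolding invertible_right_inverse matrix_inv_eqI[OF inv] by auto
  qed
  then show ?thesis
    unfolding is_scale_function_def eventually_at_top_linorder using cont by blast
qed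

text \<open>
  Entrywise, the difference of two scale functions is continuous with vanishing transform.
\<close>

lemma is_scale_function_unique:
  fixes W W' :: "real \<Rightarrow> real^'n^'n"
  assumes W: "is_scale_function F W" and W': "is_scale_function F W'" and "0 \<le> x"
  shows "W x = W' x"
proof -
  have "W x $ i $ j - W' x $ i $ j = 0" for i j
  proof (rule Laplace_transform_zero_imp_zero[OF _ _ \<open>0 \<le> x\<close>])
    show "continuous_on {0..} (\<lambda>x. W x $ i $ j - W' x $ i $ j)"
      using W W' unfolding is_scale_function_def by (intro continuous_intros) auto
    have nth: "bounded_linear (\<lambda>M :: real^'n^'n. M $ i $ j)"
      by (rule bounded_linear_compose[OF bounded_linear_vec_nth bounded_linear_vec_nth])
    have "\<forall>\<^sub>F s in at_top. ((\<lambda>x. exp (- s * x) *\<^sub>R W x) has_integral matrix_inv (F s)) {0..}"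
      "\<forall>\<^sub>F s in at_top. ((\<lambda>x. exp (- s * x) *\<^sub>R W' x) has_integral matrix_inv (F s)) {0..}"
      using W W' unfolding is_scale_function_def by (auto elim: eventually_mono)
    then show "\<forall>\<^sub>F s in at_top. ((\<lambda>x. exp (- s * x) * (W x $ i $ j - W' x $ i $ j)) has_integral 0) {0..}"
    proof eventually_elim
      case (elim s)
      from has_integral_linear[OF has_integral_diff[OF elim] nth]
      show ?case by (simp add: o_def right_diff_distrib)
    qed
  qed
  then show ?thesis by (simp add: vec_eq_iff)
qed

theorem proposition1:
  fixes T0 T1 \<Delta> :: "real^'n^'n"
    and \<nu>0 t0 \<nu>1 t1 :: "real^'n"
    and \<theta> G0 d :: real
    and W0 W1 :: "real \<Rightarrow> real^'n^'n"
  assumes "phase_type T0 \<nu>0 t0"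
    and "\<theta> > 0"
    and "G0 = \<nu>0 \<bullet> (matrix_inv (\<theta> *\<^sub>R mat 1 - T0) *v t0)"
    and "d = - ln G0"
    and "\<Delta> = diag_mat (matrix_inv (\<theta> *\<^sub>R mat 1 - T0) *v t0)"
    and "T1 = matrix_inv \<Delta> ** T0 ** \<Delta> - \<theta> *\<^sub>R mat 1"
    and "\<nu>1 = (1 / G0) *\<^sub>R (\<nu>0 v* \<Delta>)"
    and "t1 = matrix_inv \<Delta> *v t0"
    and "is_scale_function (map_exponent T0 \<nu>0 t0 \<theta> d) W0"
    and "is_scale_function (map_exponent T1 \<nu>1 t1 \<theta> d) W1"
  shows "\<forall>x\<ge>0. W1 x = exp x *\<^sub>R (matrix_inv \<Delta> ** W0 x ** \<Delta>)"
proof -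
  have pos: "0 < (matrix_inv (\<theta> *\<^sub>R mat 1 - T0) *v t0) $ i" for i
    by (rule resolvent_exit_rates_pos[OF assms(1,2)])
  then have \<Delta>: "invertible \<Delta>"
    unfolding assms(5) by (intro invertible_diag_mat) (rule less_imp_neq[OF pos, symmetric])
  have "probability_vector \<nu>0"
    using assms(1) by (simp add: phase_type_def)
  from inner_probability_vector_pos[OF this pos] have "0 < G0"
    by (simp only: assms(3))
  with \<Delta> have F1: "map_exponent T1 \<nu>1 t1 \<theta> d
      = (\<lambda>s. matrix_inv \<Delta> ** map_exponent T0 \<nu>0 t0 \<theta> d (s - 1) ** \<Delta>)"
    by (intro ext) (simp only: assms(4,6,7,8) map_exponent_tilt)
  show ?thesis
    using is_scale_function_unique[OF assms(10)[unfolded F1]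
        is_scale_function_similarity[OF \<Delta> assms(9)]] by blast
qed

end
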